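(* Let $X_1$ be a real random variable with law $\gamma$ and let $\Lambda(t)=\log\mathbb{E}[e^{tX_1}]$, $t\in\mathbb{R}$. Assume that $\int_{\mathbb{R}}|\Lambda(tu)|^4\,\nu(du)<\infty$ for all $t\in\mathbb{R}$, where $\nu$ is the standard Gaussian measure on $\mathbb{R}$, and that $\Lambda(t)=\Lambda(-t)$ for all $t\in\mathbb{R}$. For $w\in\mathbb{R}$ define $$\mathbb{I}_\iota(w)=\sup_{t\in\mathbb{R}}\{tw-\Lambda(t)\},\qquad \mathbb{I}_\sigma(w)=\sup_{t\in\mathbb{R}}\{tw-\Psi(t)\},\qquad \Psi(t)=\int_{\mathbb{R}}\Lambda(tu)\tfrac{1}{\sqrt{2\pi}}e^{-u^2/2}\,du.$$ Then: (a) If $\Lambda\circ\sqrt{\cdot}$ is concave on $\mathbb{R}_+$, then $\mathbb{I}_\sigma(w)\ge\mathbb{I}_\iota(w)$ for all $w\in\mathbb{R}$. (b) If $\Lambda\circ\sqrt{\cdot}$ is convex on $\mathbb{R}_+$, then $\mathbb{I}_\sigma(w)\le\mathbb{I}_\iota(w)$ for all $w\in\mathbb{R}$. (c) If $\Lambda\circ\sqrt{\cdot}$ is concave or convex, but not linear, on $\mathbb{R}_+$, then for $w\in\mathbb{R}$, $\mathbb{I}_\sigma(w)=\mathbb{I}_\iota(w)<\infty$ if and only if $w=0$.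
   Context: $\mathbb{R}_+=[0,\infty)$, and $\Lambda\circ\sqrt{\cdot}$ denotes the function $s\mapsto\Lambda(\sqrt{s})$ on $\mathbb{R}_+$. The functions $\mathbb{I}_\iota$ and $\mathbb{I}_\sigma$ take values in $[0,\infty]$. *)

theory Defs
  imports "HOL-Probability.Probability"
begin

text \<open>Logarithm from \<open>[0,\<infinity>]\<close> to \<open>[-\<infinity>,\<infinity>]\<close>.\<close>

definition ln_ennreal :: "ennreal \<Rightarrow> ereal" where
  "ln_ennreal p =
     (if p = 0 then -\<infinity> else if p = \<infinity> then \<infinity> else ereal (ln (enn2real p)))"

text \<open>
  The function \<open>\<Lambda>(t) = log E[exp (t X)]\<close>. The expectation is taken in \<open>[0,\<infinity>]\<close>, so that
  \<open>\<Lambda>(t) = \<infinity>\<close> when \<open>exp (t X)\<close> is not integrable. (The Bochner integral would return 0 there.)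
\<close>

definition log_mgf :: "'a measure \<Rightarrow> ('a \<Rightarrow> real) \<Rightarrow> real \<Rightarrow> ereal" where
  "log_mgf M X t = ln_ennreal (\<integral>\<^sup>+ x. ennreal (exp (t * X x)) \<partial>M)"

definition fourth_moment_finite :: "(real \<Rightarrow> ereal) \<Rightarrow> bool" where
  "fourth_moment_finite L \<longleftrightarrow>
     (\<forall>t. (\<integral>\<^sup>+ u. (e2ennreal \<bar>L (t * u)\<bar>) ^ 4 \<partial>std_normal_distribution) < \<infinity>)"

text \<open>
  \<open>\<Psi>(t)\<close> as a Bochner integral against the Gaussian density. It is used only under
  \<open>fourth_moment_finite L\<close>, which makes \<open>L (t * u)\<close> finite for almost all \<open>u\<close> and integrable;
  in the case \<open>L = log_mgf M X\<close> it is finite everywhere (see \<open>log_mgf_finite\<close> below), so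
  \<open>real_of_ereal\<close> does not alter any value.
\<close>

definition gauss_avg :: "(real \<Rightarrow> ereal) \<Rightarrow> real \<Rightarrow> real" where
  "gauss_avg L t = (LBINT u. real_of_ereal (L (t * u)) * std_normal_density u)"

definition legendre :: "(real \<Rightarrow> ereal) \<Rightarrow> real \<Rightarrow> ereal" where
  "legendre L w = (SUP t. ereal (t * w) - L t)"

definition rate_iota :: "(real \<Rightarrow> ereal) \<Rightarrow> real \<Rightarrow> ereal" where
  "rate_iota L w = legendre L w"

definition rate_sigma :: "(real \<Rightarrow> ereal) \<Rightarrow> real \<Rightarrow> ereal" where
  "rate_sigma L w = legendre (\<lambda>t. ereal (gauss_avg L t)) w"

definition comp_sqrt :: "(real \<Rightarrow> ereal) \<Rightarrow> real \<Rightarrow> real" where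
  "comp_sqrt L s = real_of_ereal (L (sqrt s))"

text \<open>
  Linear means \<open>s \<mapsto> c s\<close>. For \<open>log_mgf\<close> of a probability measure this coincides with affine,
  because \<open>\<Lambda>(0) = 0\<close>.
\<close>

definition linear_on_nonneg :: "(real \<Rightarrow> real) \<Rightarrow> bool" where
  "linear_on_nonneg g \<longleftrightarrow> (\<exists>c. \<forall>s\<ge>0. g s = c * s)"

lemma log_mgf_zero: "prob_space M \<Longrightarrow> log_mgf M X 0 = 0"
  by (simp add: log_mgf_def ln_ennreal_def prob_space.emeasure_space_1)

lemma log_mgf_finite:
  assumes "prob_space M" and X: "X \<in> borel_measurable M"
    and fin: "fourth_moment_finite (log_mgf M X)"
    and sym: "\<And>t. log_mgf M X t = log_mgf M X (- t)"
  shows "\<bar>log_mgf M X t\<bar> \<noteq> \<infinity>"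
proof -
  interpret prob_space M by fact
  define mgf where "mgf = (\<lambda>s. \<integral>\<^sup>+ x. ennreal (exp (s * X x)) \<partial>M)"
  have top_iff: "log_mgf M X s = \<infinity> \<longleftrightarrow> mgf s = \<infinity>" for s
    by (auto simp: log_mgf_def mgf_def ln_ennreal_def)
  have "\<exists>u. \<bar>t\<bar> < u \<and> mgf u \<noteq> \<infinity>"
  proof (rule ccontr)
    assume "\<not> ?thesis"
    then have inf: "log_mgf M X u = \<infinity>" if "\<bar>t\<bar> < u" for u
      using that top_iff by blast
    have "(\<integral>\<^sup>+ u. \<infinity> * indicator {\<bar>t\<bar><..} u \<partial>std_normal_distribution)
        \<le> (\<integral>\<^sup>+ u. (e2ennreal \<bar>log_mgf M X (1 * u)\<bar>) ^ 4 \<partial>std_normal_distribution)"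
      by (intro nn_integral_mono) (auto simp: inf indicator_def e2ennreal_infty split: if_splits)
    also have "\<dots> < \<infinity>"
      using fin unfolding fourth_moment_finite_def by blast
    finally have "\<infinity> * emeasure std_normal_distribution {\<bar>t\<bar><..} < \<infinity>"
      by (simp add: nn_integral_cmult_indicator)
    then have "emeasure std_normal_distribution {\<bar>t\<bar><..} = 0"
      by (metis ennreal_top_mult infinity_ennreal_def less_irrefl)
    then have "AE u in lborel. u \<notin> {\<bar>t\<bar><..}"
      by (subst (asm) emeasure_density, simp, simp, subst (asm) nn_integral_0_iff_AE)
         (auto elim!: eventually_mono simp: indicator_def normal_density_pos[of 1 0, THEN less_imp_neq, symmetric] split: if_splits)
    then have "emeasure lborel {\<bar>t\<bar><..} = 0"
      by (subst (asm) AE_iff_measurable[where N = "{\<bar>t\<bar><..}"]) auto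
    moreover have "emeasure lborel {\<bar>t\<bar><..<\<bar>t\<bar>+1} \<le> emeasure lborel {\<bar>t\<bar><..}"
      by (intro emeasure_mono) auto
    ultimately show False by simp
  qed
  then obtain u where u: "\<bar>t\<bar> < u" "mgf u \<noteq> \<infinity>" by blast
  have "mgf (- u) \<noteq> \<infinity>" using u(2) sym[of u] top_iff by metis
  have "mgf t \<le> (\<integral>\<^sup>+ x. ennreal (exp (u * X x)) + ennreal (exp (- u * X x)) \<partial>M)"
    unfolding mgf_def
  proof (intro nn_integral_mono)
    fix x
    have "t * X x \<le> \<bar>t\<bar> * \<bar>X x\<bar>" by (metis abs_ge_self abs_mult)
    also have "\<dots> \<le> u * \<bar>X x\<bar>" using u(1) by (intro mult_right_mono) auto
    finally have "exp (t * X x) \<le> exp (u * \<bar>X x\<bar>)" by simp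
    also have "\<dots> \<le> exp (u * X x) + exp (- u * X x)"
      by (cases "X x \<ge> 0") auto
    finally show "ennreal (exp (t * X x)) \<le> ennreal (exp (u * X x)) + ennreal (exp (- u * X x))"
      by (simp flip: ennreal_plus)
  qed
  also have "\<dots> = mgf u + mgf (- u)"
    unfolding mgf_def using X by (subst nn_integral_add) auto
  also have "\<dots> < \<infinity>"
    using u(2) \<open>mgf (- u) \<noteq> \<infinity>\<close> by (simp add: less_top)
  finally have "mgf t \<noteq> \<infinity>" by simp
  moreover have "mgf t \<noteq> 0"
  proof
    assume "mgf t = 0"
    then have "AE x in M. ennreal (exp (t * X x)) = 0"
      unfolding mgf_def using X by (subst (asm) nn_integral_0_iff_AE) auto
    then have "AE x in M. False" by (auto elim!: eventually_mono simp: ennreal_eq_0_iff not_le[symmetric])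
    then show False by simp
  qed
  ultimately show ?thesis
    by (auto simp: log_mgf_def mgf_def ln_ennreal_def)
qed

end

theory Submission
  imports Defs
begin

text \<open>
  Put \<open>g(s) = \<Lambda>(\<surd>s)\<close>. As \<open>\<Lambda>\<close> is even, \<open>\<Lambda>(t) = g(t\<^sup>2)\<close> and \<open>\<Psi>(t) = E g(t\<^sup>2 U\<^sup>2)\<close> with \<open>U\<close>
  standard Gaussian. Since \<open>E U\<^sup>2 = 1\<close>, Jensen's inequality compares \<open>\<Psi>(t)\<close> with \<open>\<Lambda>(t)\<close>
  (\<open>gauss_jensen\<close>), and the Legendre transform reverses the order. This settles the two
  non-strict claims.

  For the equality case, \<open>U\<^sup>2\<close> has full support on the half-line, so equality in Jensen's
  inequality at a single \<open>t \<noteq> 0\<close> would make \<open>g\<close> affine, hence linear because \<open>g(0) = 0\<close>. Thus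
  \<open>\<Psi>\<close> and \<open>\<Lambda>\<close> differ strictly away from the origin. This passes to the Legendre
  transforms, which are even, at \<open>w > 0\<close> if the supremum for the larger of the two functions is attained, and if the
  transform of the smaller one is positive, so that a maximum at \<open>t = 0\<close> does no harm
  (\<open>legendre_strict_antimono\<close>).

  Positivity holds because \<open>\<Lambda>(t) \<le> C t\<^sup>2\<close> near the origin. Attainment holds if the function
  eventually exceeds \<open>t w\<close>. In the convex case \<open>\<Psi>\<close> does so, since \<open>g\<close> grows at least linearly
  and so \<open>\<Psi> \<ge> \<Lambda>\<close> grows at least quadratically. In the concave case \<open>\<Lambda>\<close> may fail to do so,
  as with \<open>\<Lambda> = log cosh\<close> and \<open>w = 1\<close>. But then \<open>\<Lambda>(t) \<le> \<bar>t\<bar> w\<close> everywhere, so that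
  \<open>\<Psi>(t) \<le> \<bar>t\<bar> w E\<bar>U\<bar>\<close>; as \<open>E\<bar>U\<bar> = \<surd>(2/\<pi>) < 1\<close>, the transform of \<open>\<Psi>\<close> at \<open>w\<close> is infinite
  (\<open>rate_Psi_infinite\<close>), whereas the transform of \<open>\<Lambda>\<close> is assumed finite.
\<close>

section \<open>Legendre transforms\<close>

lemma ereal_le_legendre: "ereal (t * w - f t) \<le> legendre (\<lambda>t. ereal (f t)) w"
  unfolding legendre_def by (rule SUP_upper2[of t]) auto

lemma legendre_antimono:
  assumes "\<And>t. f t \<le> g t"
  shows "legendre (\<lambda>t. ereal (g t)) w \<le> legendre (\<lambda>t. ereal (f t)) w"
  unfolding legendre_def by (intro SUP_mono bexI) (auto intro: diff_left_mono assms)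

lemma legendre_even:
  assumes "\<And>t. L (- t) = L t"
  shows "legendre L (- w) = legendre L w"
proof -
  have le: "legendre L (- v) \<le> legendre L v" for v
    unfolding legendre_def
  proof (rule SUP_mono)
    fix t
    show "\<exists>s\<in>UNIV. ereal (t * - v) - L t \<le> ereal (s * v) - L s"
      by (rule bexI[of _ "- t"]) (simp_all add: assms)
  qed
  from le[of w] le[of "- w"] show ?thesis by simp
qed

lemma legendre_zero_at_0:
  assumes "\<And>t. 0 \<le> f t" "f 0 = 0"
  shows "legendre (\<lambda>t. ereal (f t)) 0 = 0"
proof (rule antisym)
  show "legendre (\<lambda>t. ereal (f t)) 0 \<le> 0"
    unfolding legendre_def using assms by (intro SUP_least) auto
  show "0 \<le> legendre (\<lambda>t. ereal (f t)) 0"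
    using ereal_le_legendre[of 0 0 f] assms by (simp add: zero_ereal_def)
qed

text \<open>
  Outside \<open>[0, T]\<close> the expression \<open>t w - f t\<close> is at most \<open>0\<close>, its value at the origin, so
  only a compact interval matters.
\<close>

lemma legendre_attained:
  fixes f :: "real \<Rightarrow> real"
  assumes cont: "continuous_on UNIV f" and nonneg: "\<And>t. 0 \<le> f t" and zero: "f 0 = 0"
    and "0 < w" and far: "\<And>t. T \<le> t \<Longrightarrow> t * w \<le> f t"
  obtains t where "legendre (\<lambda>t. ereal (f t)) w = ereal (t * w - f t)"
proof -
  have c: "continuous_on {0..max 0 T} (\<lambda>t. t * w - f t)"
    by (intro continuous_intros continuous_on_subset[OF cont]) auto
  obtain t where t: "t \<in> {0..max 0 T}"
    and max: "\<And>s. s \<in> {0..max 0 T} \<Longrightarrow> s * w - f s \<le> t * w - f t"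
    using continuous_attains_sup[OF _ _ c] by auto
  have "0 \<le> t * w - f t"
    using max[of 0] zero by simp
  moreover have "s * w - f s \<le> 0" if "s \<notin> {0..max 0 T}" for s
  proof (cases "s < 0")
    case True
    then show ?thesis using nonneg[of s] \<open>0 < w\<close> mult_neg_pos[of s w] by linarith
  next
    case False
    then show ?thesis using that far[of s] by auto
  qed
  ultimately have "s * w - f s \<le> t * w - f t" for s
    using max[of s] by (meson order_trans)
  then have "legendre (\<lambda>t. ereal (f t)) w \<le> ereal (t * w - f t)"
    unfolding legendre_def by (intro SUP_least) auto
  then show ?thesis
    using ereal_le_legendre[of t w f] by (intro that[of t]) (rule antisym)
qed

text \<open>
  Evaluating \<open>h\<close> at a maximiser for \<open>f\<close> gives a strictly larger value, unless that maximiser is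
  the origin; in that case the transform of \<open>f\<close> vanishes.
\<close>

lemma legendre_strict_antimono:
  fixes f :: "real \<Rightarrow> real"
  assumes "continuous_on UNIV f" "\<And>t. 0 \<le> f t" "f 0 = 0"
    and "0 < w" "\<And>t. T \<le> t \<Longrightarrow> t * w \<le> f t"
    and less: "\<And>t. t \<noteq> 0 \<Longrightarrow> h t < f t"
    and pos: "0 < legendre (\<lambda>t. ereal (h t)) w"
  shows "legendre (\<lambda>t. ereal (f t)) w < legendre (\<lambda>t. ereal (h t)) w"
proof -
  obtain t where t: "legendre (\<lambda>t. ereal (f t)) w = ereal (t * w - f t)"
    using legendre_attained[OF assms(1-5)] by blast
  show ?thesis
  proof (cases "t = 0")
    case True
    then show ?thesis using t pos \<open>f 0 = 0\<close> by (simp add: zero_ereal_def)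
  next
    case False
    then have "ereal (t * w - f t) < ereal (t * w - h t)" using less by simp
    also have "\<dots> \<le> legendre (\<lambda>t. ereal (h t)) w" by (rule ereal_le_legendre)
    finally show ?thesis by (simp add: t)
  qed
qed

lemma convex_on_chord_origin:
  fixes f :: "real \<Rightarrow> real"
  assumes "convex_on S f" "f 0 = 0" "0 \<in> S" "b \<in> S" "0 \<le> a" "a \<le> b"
  shows "b * f a \<le> a * f b"
proof (cases "b = 0")
  case False
  then have b: "0 < b" using assms by simp
  have "f ((1 - a / b) *\<^sub>R 0 + (a / b) *\<^sub>R b) \<le> (1 - a / b) * f 0 + (a / b) * f b"
    using assms b by (intro convex_onD[OF assms(1)]) auto
  then have "f a \<le> (a / b) * f b" using b assms by simp
  then show ?thesis using b by (simp add: field_simps)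
qed (use assms in auto)

section \<open>Jensen's inequality for a squared Gaussian variable\<close>

lemma linear_on_nonneg_uminus: "linear_on_nonneg (\<lambda>s. - k s) \<Longrightarrow> linear_on_nonneg k"
  unfolding linear_on_nonneg_def by (metis minus_equation_iff mult_minus_left)

lemma std_normal_has_integral_quadratic:
  "has_bochner_integral lborel (\<lambda>u. (a + b * u\<^sup>2) * std_normal_density u) (a + b)"
proof -
  have 0: "has_bochner_integral lborel (\<lambda>u. std_normal_density u) 1"
    using std_normal_moment_even[of 0] by simp
  have 2: "has_bochner_integral lborel (\<lambda>u. std_normal_density u * u\<^sup>2) 1"
    using std_normal_moment_even[of 1] by simp
  have "has_bochner_integral lborel
      (\<lambda>u. a * std_normal_density u + b * (std_normal_density u * u\<^sup>2)) (a * 1 + b * 1)"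
    by (intro has_bochner_integral_add has_bochner_integral_mult_right 0 2)
  then show ?thesis by (simp add: algebra_simps)
qed

text \<open>
  The Gaussian density is positive, so \<open>f\<close> vanishes almost everywhere; its zero set is closed and
  has full Lebesgue measure, hence is the whole line.
\<close>

lemma std_normal_integral_eq_0_imp:
  fixes f :: "real \<Rightarrow> real"
  assumes cont: "continuous_on UNIV f" and nonneg: "\<And>u. 0 \<le> f u"
    and int: "integrable lborel (\<lambda>u. f u * std_normal_density u)"
    and zero: "(LBINT u. f u * std_normal_density u) = 0"
  shows "f u = 0"
proof -
  have "AE u in lborel. f u * std_normal_density u = 0"
    using integral_nonneg_eq_0_iff_AE[OF int] nonneg zero by auto
  then have "AE u in lborel. u \<in> f -` {0}"
    by eventually_elim (use normal_density_pos[of 1 0] in \<open>auto simp: less_le\<close>)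
  then have "AE u in lebesgue. u \<in> f -` {0}"
    by (rule AE_completion)
  moreover have "closed (f -` {0})"
    using cont by (intro closed_vimage) auto
  ultimately show ?thesis
    using mem_closed_if_AE_lebesgue by blast
qed

lemma convex_on_supporting_line:
  fixes k :: "real \<Rightarrow> real"
  assumes "convex_on S k" "x \<in> interior S"
  obtains c where "\<And>y. y \<in> S \<Longrightarrow> k x + c * (y - x) \<le> k y"
  using convex_le_Inf_differential[OF assms] by blast

text \<open>
  The gap between \<open>k\<close> and a supporting line at \<open>t\<^sup>2 = E (t U)\<^sup>2\<close> is nonnegative, and its Gaussian mean
  is the difference of the two sides. If the mean vanishes, then \<open>k\<close> coincides with the supporting
  line on the whole half-line, since \<open>(t u)\<^sup>2\<close> takes every value \<open>s \<ge> 0\<close>.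
\<close>

lemma gauss_jensen:
  fixes k :: "real \<Rightarrow> real"
  assumes conv: "convex_on {0..} k" and "t \<noteq> 0"
    and int: "integrable lborel (\<lambda>u. k ((t * u)\<^sup>2) * std_normal_density u)"
  shows "k (t\<^sup>2) \<le> (LBINT u. k ((t * u)\<^sup>2) * std_normal_density u)"
    and "continuous_on {0..} k \<Longrightarrow> k 0 = 0 \<Longrightarrow> \<not> linear_on_nonneg k \<Longrightarrow>
      k (t\<^sup>2) < (LBINT u. k ((t * u)\<^sup>2) * std_normal_density u)"
proof -
  let ?I = "LBINT u. k ((t * u)\<^sup>2) * std_normal_density u"
  have "t\<^sup>2 \<in> interior {0..}" using \<open>t \<noteq> 0\<close> by simp
  then obtain c where c: "\<And>y. 0 \<le> y \<Longrightarrow> k (t\<^sup>2) + c * (y - t\<^sup>2) \<le> k y"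
    using convex_on_supporting_line[OF conv] by (metis atLeast_iff)
  define gap where "gap u = k ((t * u)\<^sup>2) - (k (t\<^sup>2) + c * ((t * u)\<^sup>2 - t\<^sup>2))" for u
  have gap_nonneg: "0 \<le> gap u" for u
    using c[of "(t * u)\<^sup>2"] by (simp add: gap_def)
  have "has_bochner_integral lborel (\<lambda>u. k ((t * u)\<^sup>2) * std_normal_density u
      - (k (t\<^sup>2) - c * t\<^sup>2 + c * t\<^sup>2 * u\<^sup>2) * std_normal_density u)
      (?I - (k (t\<^sup>2) - c * t\<^sup>2 + c * t\<^sup>2))"
    by (intro has_bochner_integral_diff std_normal_has_integral_quadratic
        has_bochner_integral_integrable int)
  then have gap_int: "has_bochner_integral lborel (\<lambda>u. gap u * std_normal_density u) (?I - k (t\<^sup>2))"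
    by (simp add: gap_def algebra_simps power_mult_distrib)
  have "0 \<le> (LBINT u. gap u * std_normal_density u)"
    using gap_nonneg by (intro integral_nonneg_AE) auto
  then show le: "k (t\<^sup>2) \<le> ?I"
    using has_bochner_integral_integral_eq[OF gap_int] by simp
  assume cont: "continuous_on {0..} k" and "k 0 = 0" and nonlin: "\<not> linear_on_nonneg k"
  show "k (t\<^sup>2) < ?I"
  proof (rule ccontr)
    assume "\<not> ?thesis"
    then have "?I - k (t\<^sup>2) = 0" using le by simp
    then have "(LBINT u. gap u * std_normal_density u) = 0"
      using has_bochner_integral_integral_eq[OF gap_int] by simp
    moreover have "continuous_on UNIV (\<lambda>u. k ((t * u)\<^sup>2))"
      by (rule continuous_on_compose2[OF cont]) (auto intro!: continuous_intros)
    then have "continuous_on UNIV gap"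
      unfolding gap_def by (intro continuous_intros)
    ultimately have gap0: "gap u = 0" for u
      using std_normal_integral_eq_0_imp gap_nonneg has_bochner_integral_iff gap_int by blast
    have "k s = k (t\<^sup>2) + c * (s - t\<^sup>2)" if "0 \<le> s" for s
      using gap0[of "sqrt s / t"] that \<open>t \<noteq> 0\<close> by (simp add: gap_def)
    moreover from this[of 0] have "k (t\<^sup>2) = c * t\<^sup>2" using \<open>k 0 = 0\<close> by simp
    ultimately have "k s = c * s" if "0 \<le> s" for s
      using that by (simp add: algebra_simps)
    then show False using nonlin by (auto simp: linear_on_nonneg_def)
  qed
qed

section \<open>Comparison of the rate functions\<close>

text \<open>
  The properties of a finite even cumulant generating function on which the comparison rests. The
  quadratic bound stands in for differentiability at the origin with derivative zero.
\<close>

locale even_cumulant =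
  fixes L :: "real \<Rightarrow> real" and C :: real
  assumes convex: "convex_on UNIV L"
    and even: "L (- t) = L t"
    and zero: "L 0 = 0"
    and quadratic: "\<bar>t\<bar> \<le> 1 \<Longrightarrow> L t \<le> C * t\<^sup>2"
    and integrable_gauss: "integrable lborel (\<lambda>u. L (t * u) * std_normal_density u)"
begin

definition "g s = L (sqrt s)"

definition "\<Psi> t = (LBINT u. L (t * u) * std_normal_density u)"

abbreviation "rate f w \<equiv> legendre (\<lambda>t. ereal (f t)) w"

lemma L_eq_g: "L t = g (t\<^sup>2)"
  by (simp add: g_def abs_if even)

lemma g_zero: "g 0 = 0"
  by (simp add: g_def zero)

lemma continuous_L: "continuous_on S L"
  using convex_on_continuous[OF open_UNIV convex] continuous_on_subset by blast

lemma continuous_g: "continuous_on {0..} g"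
  unfolding g_def by (rule continuous_on_compose2[OF continuous_L[of UNIV]]) (auto intro!: continuous_intros)

lemma nonneg: "0 \<le> L t"
proof -
  have "L ((1 - 1/2) *\<^sub>R t + (1/2) *\<^sub>R (- t)) \<le> (1 - 1/2) * L t + (1/2) * L (- t)"
    by (intro convex_onD[OF convex]) auto
  then show ?thesis by (simp add: even zero)
qed

lemma g_nonneg: "0 \<le> g s"
  by (simp add: g_def nonneg)

lemma Psi_zero: "\<Psi> 0 = 0"
  by (simp add: \<Psi>_def zero)

lemma Psi_nonneg: "0 \<le> \<Psi> t"
  unfolding \<Psi>_def by (intro integral_nonneg_AE) (simp add: nonneg)

lemma Psi_even: "\<Psi> (- t) = \<Psi> t"
  by (simp add: \<Psi>_def even)

lemma Psi_convex: "convex_on UNIV \<Psi>"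
proof (rule convex_onI)
  fix \<theta> x y :: real
  assume \<theta>: "0 < \<theta>" "\<theta> < 1"
  have "\<Psi> ((1 - \<theta>) *\<^sub>R x + \<theta> *\<^sub>R y)
      \<le> (LBINT u. (1 - \<theta>) * (L (x * u) * std_normal_density u) + \<theta> * (L (y * u) * std_normal_density u))"
    unfolding \<Psi>_def
  proof (intro integral_mono Bochner_Integration.integrable_add integrable_mult_right integrable_gauss)
    fix u
    have "L ((1 - \<theta>) *\<^sub>R (x * u) + \<theta> *\<^sub>R (y * u)) \<le> (1 - \<theta>) * L (x * u) + \<theta> * L (y * u)"
      using \<theta> by (intro convex_onD[OF convex]) auto
    then have "L (((1 - \<theta>) *\<^sub>R x + \<theta> *\<^sub>R y) * u) * std_normal_density u
        \<le> ((1 - \<theta>) * L (x * u) + \<theta> * L (y * u)) * std_normal_density u"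
      by (intro mult_right_mono) (auto simp: algebra_simps)
    then show "L (((1 - \<theta>) *\<^sub>R x + \<theta> *\<^sub>R y) * u) * std_normal_density u
        \<le> (1 - \<theta>) * (L (x * u) * std_normal_density u) + \<theta> * (L (y * u) * std_normal_density u)"
      by (simp add: algebra_simps)
  qed
  also have "\<dots> = (1 - \<theta>) * \<Psi> x + \<theta> * \<Psi> y"
    unfolding \<Psi>_def by (subst Bochner_Integration.integral_add) (auto intro!: integrable_mult_right integrable_gauss)
  finally show "\<Psi> ((1 - \<theta>) *\<^sub>R x + \<theta> *\<^sub>R y) \<le> (1 - \<theta>) * \<Psi> x + \<theta> * \<Psi> y" .
qed auto

lemma integrable_gauss_g: "integrable lborel (\<lambda>u. g ((t * u)\<^sup>2) * std_normal_density u)"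
  using integrable_gauss[of t] by (simp only: L_eq_g)

lemma Psi_eq: "\<Psi> t = (LBINT u. g ((t * u)\<^sup>2) * std_normal_density u)"
  by (simp only: \<Psi>_def L_eq_g)

lemma L_le_Psi_if_convex: "convex_on {0..} g \<Longrightarrow> L t \<le> \<Psi> t"
  using gauss_jensen(1)[of g t] integrable_gauss_g Psi_zero zero
  by (cases "t = 0") (auto simp: Psi_eq L_eq_g)

lemma L_less_Psi_if_convex: "convex_on {0..} g \<Longrightarrow> \<not> linear_on_nonneg g \<Longrightarrow> t \<noteq> 0 \<Longrightarrow> L t < \<Psi> t"
  using gauss_jensen(2)[of g t] integrable_gauss_g continuous_g g_zero
  by (auto simp: Psi_eq L_eq_g)

lemma Psi_le_L_if_concave: "concave_on {0..} g \<Longrightarrow> \<Psi> t \<le> L t"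
  using gauss_jensen(1)[of "\<lambda>s. - g s" t] integrable_gauss_g Psi_zero zero
  by (cases "t = 0") (auto simp: Psi_eq L_eq_g concave_on_def)

lemma Psi_less_L_if_concave: "concave_on {0..} g \<Longrightarrow> \<not> linear_on_nonneg g \<Longrightarrow> t \<noteq> 0 \<Longrightarrow> \<Psi> t < L t"
  using gauss_jensen(2)[of "\<lambda>s. - g s" t] integrable_gauss_g continuous_g g_zero
    linear_on_nonneg_uminus[of g]
  by (auto simp: Psi_eq L_eq_g concave_on_def intro: continuous_on_minus)

text \<open>
  The line of slope \<open>w\<close> rises above the parabola \<open>C t\<^sup>2\<close> for small \<open>t > 0\<close>.
\<close>

lemma rate_pos:
  assumes "0 < w"
  shows "0 < rate L w"
proof -
  \<comment> \<open>Any \<open>t\<close> in \<open>(0, 1]\<close> with \<open>C t < w\<close> would do; the shift by \<open>1\<close> avoids a zero denominator.\<close>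
  define t where "t = min 1 (w / (2 * (\<bar>C\<bar> + 1)))"
  have t: "0 < t" "t \<le> 1" using assms by (auto simp: t_def)
  have "t * (\<bar>C\<bar> + 1) \<le> w / (2 * (\<bar>C\<bar> + 1)) * (\<bar>C\<bar> + 1)"
    by (intro mult_right_mono) (auto simp: t_def)
  also have "\<dots> = w / 2" by (simp add: field_simps)
  finally have "t * (\<bar>C\<bar> + 1) < w" using assms by simp
  moreover have "C * t \<le> t * (\<bar>C\<bar> + 1)"
    using t by (subst mult.commute, intro mult_left_mono) auto
  ultimately have "C * t < w" by linarith
  then have "t * (C * t) < t * w" using t by (intro mult_strict_left_mono)
  moreover have "L t \<le> C * t\<^sup>2" using t quadratic[of t] by simp
  ultimately have "0 < t * w - L t" by (simp add: power2_eq_square algebra_simps)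
  then have "0 < ereal (t * w - L t)" by simp
  also have "\<dots> \<le> rate L w" by (rule ereal_le_legendre)
  finally show ?thesis .
qed

text \<open>
  Gaussian averaging multiplies \<open>t w\<close> by the mean \<open>m = \<surd>(2/\<pi>)\<close> of \<open>\<bar>U\<bar>\<close>. Since \<open>m < 1\<close>, the
  difference \<open>t w - \<Psi> t \<ge> t w (1 - m)\<close> is unbounded.
\<close>

lemma rate_Psi_infinite:
  assumes "0 < w" and bound: "\<And>t. 0 \<le> t \<Longrightarrow> L t \<le> t * w"
  shows "rate \<Psi> w = \<infinity>"
proof -
  define m where "m = sqrt (2 / pi)"
  have "m < 1" using pi_gt3 by (simp add: m_def)
  have abs: "has_bochner_integral lborel (\<lambda>u. std_normal_density u * \<bar>u\<bar>) m"
    using std_normal_moment_abs_odd[of 0] by (simp add: m_def)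
  have Psi_le: "\<Psi> t \<le> t * w * m" if "0 \<le> t" for t
  proof -
    have "\<Psi> t \<le> (LBINT u. t * w * (std_normal_density u * \<bar>u\<bar>))"
      unfolding \<Psi>_def
    proof (intro integral_mono integrable_gauss integrable_mult_right)
      show "integrable lborel (\<lambda>u. std_normal_density u * \<bar>u\<bar>)"
        using abs by (simp add: has_bochner_integral_iff)
      fix u
      have "L (t * u) = L \<bar>t * u\<bar>" by (simp add: abs_if even)
      also have "\<dots> \<le> \<bar>t * u\<bar> * w" by (rule bound) simp
      finally have "L (t * u) \<le> t * w * \<bar>u\<bar>"
        using that by (simp add: abs_mult mult_ac)
      then have "L (t * u) * std_normal_density u \<le> t * w * \<bar>u\<bar> * std_normal_density u"
        by (intro mult_right_mono) auto
      then show "L (t * u) * std_normal_density u \<le> t * w * (std_normal_density u * \<bar>u\<bar>)"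
        by (simp add: mult_ac)
    qed
    also have "\<dots> = t * w * m"
      using has_bochner_integral_integral_eq[OF abs] by simp
    finally show ?thesis .
  qed
  show ?thesis
  proof (rule ereal_top)
    fix B
    define t where "t = \<bar>B\<bar> / (w * (1 - m))"
    have "0 \<le> t" using \<open>0 < w\<close> \<open>m < 1\<close> by (simp add: t_def)
    have "B \<le> t * w * (1 - m)" using \<open>0 < w\<close> \<open>m < 1\<close> by (simp add: t_def)
    also have "\<dots> \<le> t * w - \<Psi> t" using Psi_le[OF \<open>0 \<le> t\<close>] by (simp add: algebra_simps)
    finally have "ereal B \<le> ereal (t * w - \<Psi> t)" by simp
    also have "\<dots> \<le> rate \<Psi> w" by (rule ereal_le_legendre)
    finally show "ereal B \<le> rate \<Psi> w" .
  qed
qed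

text \<open>
  Once \<open>L\<close> exceeds the line \<open>t w\<close> at some \<open>T > 0\<close>, convexity and \<open>L 0 = 0\<close> keep it above, and the
  supremum for \<open>L\<close> is attained. If \<open>L\<close> never exceeds the line, the transform of \<open>\<Psi>\<close> is infinite.
\<close>

lemma rate_L_less_if_concave:
  assumes "concave_on {0..} g" "\<not> linear_on_nonneg g" "0 < w" "rate L w < \<infinity>"
  shows "rate L w < rate \<Psi> w"
proof (cases "\<exists>t>0. t * w < L t")
  case True
  then obtain T where T: "0 < T" "T * w < L T" by blast
  have "t * w \<le> L t" if "T \<le> t" for t
  proof -
    have "T * (t * w) \<le> t * L T" using T that by (simp add: mult_left_mono)
    also have "\<dots> \<le> T * L t"
      using T that by (intro convex_on_chord_origin[OF convex zero]) auto
    finally show ?thesis using T by simp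
  qed
  moreover have "0 < rate \<Psi> w"
    using rate_pos[OF \<open>0 < w\<close>] legendre_antimono[of \<Psi> L w] Psi_le_L_if_concave[OF assms(1)]
    by (meson less_le_trans)
  ultimately show ?thesis
    using legendre_strict_antimono[OF continuous_L nonneg zero \<open>0 < w\<close>]
      Psi_less_L_if_concave[OF assms(1,2)] by blast
next
  case False
  then have "L t \<le> t * w" if "0 \<le> t" for t
    using that zero by (cases "t = 0") (force simp: not_less less_le)+
  then have "rate \<Psi> w = \<infinity>" by (rule rate_Psi_infinite[OF \<open>0 < w\<close>])
  then show ?thesis using assms(4) by simp
qed

text \<open>
  Convexity and \<open>g 0 = 0\<close> make \<open>g s / s\<close> nondecreasing, so one positive value of \<open>g\<close> forces linear
  growth of \<open>g\<close>, that is, quadratic growth of \<open>L\<close> and of \<open>\<Psi> \<ge> L\<close>.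
\<close>

lemma rate_Psi_less_if_convex:
  assumes conv: "convex_on {0..} g" and nonlin: "\<not> linear_on_nonneg g" and "0 < w"
  shows "rate \<Psi> w < rate L w"
proof -
  obtain s where s: "0 \<le> s" "g s \<noteq> 0 * s"
    using nonlin unfolding linear_on_nonneg_def by blast
  then have "0 < s" "0 < g s"
    using g_zero g_nonneg[of s] by (cases "s = 0"; auto simp: less_le)+
  \<comment> \<open>Beyond \<open>\<surd>s\<close> the bound \<open>L t \<ge> t\<^sup>2 g(s) / s\<close> holds, and beyond \<open>s w / g(s)\<close> it is at least \<open>t w\<close>.\<close>
  define T where "T = max (sqrt s) (s * w / g s)"
  have "t * w \<le> \<Psi> t" if "T \<le> t" for t
  proof -
    have t: "sqrt s \<le> t" "s * w / g s \<le> t" using that by (auto simp: T_def)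
    then have "0 < t" using \<open>0 < s\<close> by (meson less_le_trans real_sqrt_gt_zero)
    have "s * w \<le> t * g s" using t \<open>0 < g s\<close> by (simp add: field_simps)
    then have "s * (t * w) \<le> t\<^sup>2 * g s"
      using \<open>0 < t\<close> by (simp add: power2_eq_square mult_left_mono mult.assoc mult.left_commute[of s])
    also have "s \<le> t\<^sup>2" using t \<open>0 < s\<close> by (simp add: real_le_rsqrt sqrt_le_D)
    then have "t\<^sup>2 * g s \<le> s * g (t\<^sup>2)"
      using \<open>0 < s\<close> by (intro convex_on_chord_origin[OF conv g_zero]) auto
    finally have "t * w \<le> L t" using \<open>0 < s\<close> by (simp add: L_eq_g)
    also have "\<dots> \<le> \<Psi> t" by (rule L_le_Psi_if_convex[OF conv])
    finally show ?thesis .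
  qed
  then show ?thesis
    using legendre_strict_antimono[OF convex_on_continuous[OF open_UNIV Psi_convex]
        Psi_nonneg Psi_zero \<open>0 < w\<close>] rate_pos[OF \<open>0 < w\<close>] L_less_Psi_if_convex[OF conv nonlin] by blast
qed

lemma rates_comparison:
  shows "concave_on {0..} g \<Longrightarrow> rate L w \<le> rate \<Psi> w"
    and "convex_on {0..} g \<Longrightarrow> rate \<Psi> w \<le> rate L w"
    and "concave_on {0..} g \<or> convex_on {0..} g \<Longrightarrow> \<not> linear_on_nonneg g \<Longrightarrow>
      rate \<Psi> w = rate L w \<and> rate L w < \<infinity> \<longleftrightarrow> w = 0"
proof -
  show "concave_on {0..} g \<Longrightarrow> rate L w \<le> rate \<Psi> w"
    by (intro legendre_antimono Psi_le_L_if_concave)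
  show "convex_on {0..} g \<Longrightarrow> rate \<Psi> w \<le> rate L w"
    by (intro legendre_antimono L_le_Psi_if_convex)
  assume cc: "concave_on {0..} g \<or> convex_on {0..} g" and nonlin: "\<not> linear_on_nonneg g"
  have ne: "rate \<Psi> v \<noteq> rate L v" if "0 < v" "rate L v < \<infinity>" for v
    using cc rate_L_less_if_concave[OF _ nonlin that] rate_Psi_less_if_convex[OF _ nonlin that(1)] by force
  have "rate L \<bar>w\<bar> = rate L w" "rate \<Psi> \<bar>w\<bar> = rate \<Psi> w"
    using legendre_even[of "\<lambda>t. ereal (L t)" w] legendre_even[of "\<lambda>t. ereal (\<Psi> t)" w]
    by (auto simp: abs_if even Psi_even)
  then show "rate \<Psi> w = rate L w \<and> rate L w < \<infinity> \<longleftrightarrow> w = 0"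
    using ne[of "\<bar>w\<bar>"] legendre_zero_at_0[of L] legendre_zero_at_0[of \<Psi>]
      nonneg zero Psi_nonneg Psi_zero
    by (cases "w = 0") auto
qed

end

section \<open>Logarithmic moment generating functions\<close>

text \<open>
  In the power series of \<open>cosh (t x) - 1\<close> every term carries a factor \<open>t ^ n\<close> with \<open>n \<ge> 2\<close> even,
  and \<open>t ^ n \<le> t\<^sup>2\<close>.
\<close>

lemma cosh_scaled_le:
  fixes x :: real
  assumes "\<bar>t\<bar> \<le> 1"
  shows "cosh (t * x) \<le> 1 + t\<^sup>2 * (cosh x - 1)"
proof -
  let ?c = "\<lambda>y n. if even n then y ^ n /\<^sub>R fact n else 0 :: real"
  have s: "(\<lambda>n. t\<^sup>2 * ?c x n + (if n = 0 then 1 - t\<^sup>2 else 0)) sums (t\<^sup>2 * cosh x + (1 - t\<^sup>2))"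
    by (intro sums_add sums_mult cosh_converges) (rule sums_single)
  have "?c (t * x) n \<le> t\<^sup>2 * ?c x n + (if n = 0 then 1 - t\<^sup>2 else 0)" for n
  proof (cases "even n \<and> n \<noteq> 0")
    case True
    then have "2 \<le> n" by presburger
    have "t ^ n = \<bar>t\<bar> ^ n" using True by (simp add: power_even_abs)
    also have "\<dots> \<le> \<bar>t\<bar>\<^sup>2" using assms \<open>2 \<le> n\<close> by (intro power_decreasing) auto
    finally have "t ^ n * (x ^ n / fact n) \<le> t\<^sup>2 * (x ^ n / fact n)"
      using True by (intro mult_right_mono) (auto simp: zero_le_even_power)
    then show ?thesis using True by (simp add: power_mult_distrib divide_inverse mult_ac)
  qed auto
  then have "cosh (t * x) \<le> t\<^sup>2 * cosh x + (1 - t\<^sup>2)"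
    using sums_le[OF _ cosh_converges s] by blast
  then show ?thesis by (simp add: algebra_simps)
qed

lemma log_mgf_expectation:
  assumes [measurable]: "X \<in> borel_measurable M" and l: "log_mgf M X t = ereal l"
  shows "has_bochner_integral M (\<lambda>x. exp (t * X x)) (exp l)"
proof -
  let ?m = "\<integral>\<^sup>+ x. ennreal (exp (t * X x)) \<partial>M"
  have "?m \<noteq> 0" "?m \<noteq> \<infinity>" "l = ln (enn2real ?m)"
    using l by (auto simp: log_mgf_def ln_ennreal_def split: if_splits)
  then have "?m = ennreal (exp l)"
    by (cases ?m) (auto simp: ennreal_eq_0_iff)
  then show ?thesis
    by (intro has_bochner_integral_nn_integral) auto
qed

lemma has_bochner_integral_mono:
  fixes f h :: "'a \<Rightarrow> real"
  assumes "has_bochner_integral M f a" "has_bochner_integral M h b" "\<And>x. f x \<le> h x"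
  shows "a \<le> b"
  using assms integral_mono[of M f h] by (simp add: has_bochner_integral_iff)

text \<open>
  Let \<open>c = (1 - \<theta>) a + \<theta> b\<close> and \<open>l = (1 - \<theta>) L a + \<theta> L b\<close>. Normalising each exponential to have mean
  one reduces Hoelder's inequality to the pointwise convexity of \<open>exp\<close>: the mean of
  \<open>exp (c X - l)\<close> is at most a convex combination of ones.
\<close>

lemma log_mgf_convex:
  assumes [measurable]: "X \<in> borel_measurable M" and L: "\<And>t. log_mgf M X t = ereal (L t)"
  shows "convex_on UNIV L"
proof (rule convex_onI)
  fix \<theta> a b :: real
  assume \<theta>: "0 < \<theta>" "\<theta> < 1"
  define c where "c = (1 - \<theta>) * a + \<theta> * b"
  define l where "l = (1 - \<theta>) * L a + \<theta> * L b"
  have tilt: "has_bochner_integral M (\<lambda>x. exp (t * X x - k)) (exp (L t - k))" for t k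
    using has_bochner_integral_divide_zero[OF log_mgf_expectation[OF assms(1) L, of t], of "exp k"]
    by (simp add: exp_diff)
  have int: "has_bochner_integral M
      (\<lambda>x. (1 - \<theta>) * exp (a * X x - L a) + \<theta> * exp (b * X x - L b))
      ((1 - \<theta>) * exp (L a - L a) + \<theta> * exp (L b - L b))"
    by (intro has_bochner_integral_add has_bochner_integral_mult_right tilt)
  have "exp (c * X x - l) \<le> (1 - \<theta>) * exp (a * X x - L a) + \<theta> * exp (b * X x - L b)" for x
    using convex_onD[OF exp_convex, of \<theta> "a * X x - L a" "b * X x - L b"] \<theta>
    by (simp add: c_def l_def algebra_simps)
  then have "exp (L c - l) \<le> (1 - \<theta>) * exp (L a - L a) + \<theta> * exp (L b - L b)"
    by (rule has_bochner_integral_mono[OF tilt int])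
  then have "exp (L c - l) \<le> 1" by simp
  then show "L ((1 - \<theta>) *\<^sub>R a + \<theta> *\<^sub>R b) \<le> (1 - \<theta>) * L a + \<theta> * L b"
    by (simp add: c_def l_def)
qed auto

text \<open>
  Since \<open>L\<close> is even, \<open>exp (L t)\<close> is the mean of \<open>cosh (t X)\<close>, to which the bound on \<open>cosh\<close> applies;
  then \<open>L t \<le> exp (L t) - 1\<close>.
\<close>

lemma log_mgf_quadratic_bound:
  assumes "prob_space M" and [measurable]: "X \<in> borel_measurable M"
    and L: "\<And>t. log_mgf M X t = ereal (L t)" and even: "\<And>t. L (- t) = L t"
    and t: "\<bar>t\<bar> \<le> 1"
  shows "L t \<le> (exp (L 1) - 1) * t\<^sup>2"
proof -
  interpret prob_space M by fact
  have cosh: "has_bochner_integral M (\<lambda>x. cosh (s * X x)) (exp (L s))" for s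
  proof -
    have "has_bochner_integral M (\<lambda>x. (exp (s * X x) + exp (- s * X x)) / 2)
        ((exp (L s) + exp (L (- s))) / 2)"
      by (intro has_bochner_integral_divide_zero has_bochner_integral_add
          log_mgf_expectation assms L)
    then show ?thesis by (simp add: cosh_def even scaleR_conv_of_real)
  qed
  have one: "has_bochner_integral M (\<lambda>x. 1) (1::real)"
    by (simp add: has_bochner_integral_iff prob_space)
  have "has_bochner_integral M (\<lambda>x. 1 + t\<^sup>2 * (cosh (1 * X x) - 1)) (1 + t\<^sup>2 * (exp (L 1) - 1))"
    by (intro has_bochner_integral_add has_bochner_integral_mult_right has_bochner_integral_diff
        cosh one)
  then have "exp (L t) \<le> 1 + t\<^sup>2 * (exp (L 1) - 1)"
    by (rule has_bochner_integral_mono[OF cosh]) (simp add: cosh_scaled_le[OF t])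
  moreover have "1 + L t \<le> exp (L t)" by (rule exp_ge_add_one_self)
  ultimately show ?thesis
    unfolding mult.commute[of "t\<^sup>2"] by linarith
qed

text \<open>
  On a probability space a finite fourth moment gives a finite first moment, by \<open>y \<le> 1 + y ^ 4\<close>.
\<close>

lemma fourth_moment_finite_integrable:
  fixes L :: "real \<Rightarrow> real"
  assumes "fourth_moment_finite (\<lambda>t. ereal (L t))" and [measurable]: "L \<in> borel_measurable borel"
  shows "integrable lborel (\<lambda>u. L (t * u) * std_normal_density u)"
proof -
  interpret N: prob_space std_normal_distribution
    by (rule prob_space_normal_density) simp
  have "integrable std_normal_distribution (\<lambda>u. \<bar>L (t * u)\<bar> ^ 4)"
  proof (rule integrableI_bounded)
    have "(\<integral>\<^sup>+ u. ennreal (norm (\<bar>L (t * u)\<bar> ^ 4)) \<partial>std_normal_distribution)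
        = (\<integral>\<^sup>+ u. (e2ennreal \<bar>ereal (L (t * u))\<bar>) ^ 4 \<partial>std_normal_distribution)"
      by (intro nn_integral_cong) (simp add: e2ennreal_ereal ennreal_power)
    also have "\<dots> < \<infinity>"
      using assms(1) unfolding fourth_moment_finite_def by blast
    finally show "(\<integral>\<^sup>+ u. ennreal (norm (\<bar>L (t * u)\<bar> ^ 4)) \<partial>std_normal_distribution) < \<infinity>" .
  qed measurable
  then have "integrable std_normal_distribution (\<lambda>u. 1 + \<bar>L (t * u)\<bar> ^ 4)"
    by simp
  then have "integrable std_normal_distribution (\<lambda>u. L (t * u))"
  proof (rule Bochner_Integration.integrable_bound)
    have "y \<le> 1 + y ^ 4" if "0 \<le> y" for y :: real
    proof (cases "y \<le> 1")
      case False
      then have "y ^ 1 \<le> y ^ 4" by (intro power_increasing) auto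
      then show ?thesis by simp
    qed (use that in \<open>auto intro: add_increasing2\<close>)
    from this[OF abs_ge_zero]
    show "AE u in std_normal_distribution. norm (L (t * u)) \<le> norm (1 + \<bar>L (t * u)\<bar> ^ 4)"
      by (intro AE_I2) (simp add: abs_of_nonneg)
  qed measurable
  then show ?thesis
    by (subst (asm) integrable_density) (auto simp: mult.commute)
qed

lemma even_cumulant_log_mgf:
  assumes "prob_space M" and X: "X \<in> borel_measurable M"
    and L: "\<And>t. log_mgf M X t = ereal (L t)" and even: "\<And>t. L (- t) = L t"
    and fin: "fourth_moment_finite (\<lambda>t. ereal (L t))"
  shows "even_cumulant L (exp (L 1) - 1)"
proof
  show conv: "convex_on UNIV L"
    using log_mgf_convex[OF X L] .
  show "L (- t) = L t" for t by (rule even)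
  show "L 0 = 0"
    using L[of 0] log_mgf_zero[OF assms(1), of X] by (simp add: zero_ereal_def)
  show "L t \<le> (exp (L 1) - 1) * t\<^sup>2" if "\<bar>t\<bar> \<le> 1" for t
    using log_mgf_quadratic_bound[OF assms(1) X L even that] .
  have "L \<in> borel_measurable borel"
    by (intro borel_measurable_continuous_onI convex_on_continuous[OF open_UNIV conv])
  then show "integrable lborel (\<lambda>u. L (t * u) * std_normal_density u)" for t
    by (rule fourth_moment_finite_integrable[OF fin])
qed

theorem theorem2p5:
  fixes M :: "'a measure" and X :: "'a \<Rightarrow> real" and \<gamma> :: "real measure"
    and \<Lambda> :: "real \<Rightarrow> ereal"
  assumes "prob_space M"
    and "X \<in> borel_measurable M"
    and "distr M borel X = \<gamma>"
    and "\<And>t. \<Lambda> t = log_mgf M X t"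
    and "fourth_moment_finite \<Lambda>"
    and "\<And>t. \<Lambda> t = \<Lambda> (- t)"
  shows "(concave_on {0..} (comp_sqrt \<Lambda>) \<longrightarrow> (\<forall>w. rate_sigma \<Lambda> w \<ge> rate_iota \<Lambda> w))
    \<and> (convex_on {0..} (comp_sqrt \<Lambda>) \<longrightarrow> (\<forall>w. rate_sigma \<Lambda> w \<le> rate_iota \<Lambda> w))
    \<and> ((concave_on {0..} (comp_sqrt \<Lambda>) \<or> convex_on {0..} (comp_sqrt \<Lambda>))
        \<and> \<not> linear_on_nonneg (comp_sqrt \<Lambda>)
        \<longrightarrow> (\<forall>w. (rate_sigma \<Lambda> w = rate_iota \<Lambda> w \<and> rate_iota \<Lambda> w < \<infinity>) \<longleftrightarrow> w = 0))"
proof -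
  have log_mgf: "\<Lambda> = log_mgf M X" using assms(4) by blast
  define L where "L t = real_of_ereal (\<Lambda> t)" for t
  have fin: "\<bar>\<Lambda> t\<bar> \<noteq> \<infinity>" for t
    using assms(5,6) unfolding log_mgf by (rule log_mgf_finite[OF assms(1,2)])
  then have L: "\<Lambda> = (\<lambda>t. ereal (L t))"
    by (simp add: L_def ereal_real)
  have "log_mgf M X t = ereal (L t)" for t
    using log_mgf L by (metis (no_types))
  moreover have "L (- t) = L t" for t
    using assms(6)[of t] by (simp add: L_def)
  ultimately interpret even_cumulant L "exp (L 1) - 1"
    using assms(5) unfolding L by (intro even_cumulant_log_mgf[OF assms(1,2)])
  have "comp_sqrt \<Lambda> = g"
    by (auto simp: comp_sqrt_def g_def L)
  moreover have "gauss_avg \<Lambda> = \<Psi>"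
    by (auto simp: gauss_avg_def \<Psi>_def L)
  then have "rate_sigma \<Lambda> w = rate \<Psi> w" for w
    by (simp add: rate_sigma_def)
  moreover have "rate_iota \<Lambda> w = rate L w" for w
    by (simp add: rate_iota_def L)
  ultimately show ?thesis
    using rates_comparison by simp
qed

end
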